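(* Let $D$ be a non-empty set and $X$ a Banach space. If $U\subseteq F(D,\mathbb K)$ is a BK-space, then $U_w(D,X)$ with the norm $\|f\|_w=\sup\{\|\langle f,x^*\rangle\|_U:x^*\in X^*,\ \|x^*\|\le1\}$ is a BK-space. Moreover: i. If $U$ is an order ideal, then $U_w(D,X)$ is a $b$-ideal. ii. If $U$ is a Banach ideal, then $U_w(D,X)$ is a BK $b$-ideal. iii. If $U$ does not vanish at any point, then $U_w(D,X)$ does not vanish at any point. iv. If $\{e_a\}_{a\in D}\subseteq U$, then $c_{00}(D,X)\subseteq U_w(D,X)$. v. If $U\subseteq B(D,\mathbb K)$, then $U_w(D,X)\subseteq B(D,X)$.
   Context: $\mathbb K=\mathbb R$ or $\mathbb C$. $F(D,X)$ is the vector space of all functions $D\to X$, and $B(D,X)$ the space of bounded ones with the supremum norm. A BK-space in $F(D,X)$ is a vector subspace with a complete norm for which every evaluation $u\mapsto u(a)$, $a\in D$, is continuous into $X$. For $f\in F(D,X)$, $x^*\in X^*$: $\langle f,x^*\rangle(a):=\langle f(a),x^*\rangle=x^*(f(a))$. $U_w(D,X):=\{f\in F(D,X):\langle f,x^*\rangle\in U\ \forall x^*\in X^*\}$. A vector subspace $I\subseteq F(D,\mathbb K)$ is an order ideal if $f\in F(D,\mathbb K)$, $g\in I$, $|f|\le|g|$ pointwise imply $f\in I$; a Banach ideal is an order ideal with a complete norm such that $|f|\le|g|$, $f,g\in I$, imply $\|f\|\le\|g\|$. A vector subspace $E\subseteq F(D,X)$ is a $b$-ideal if $b\cdot f\in E$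 for all $b\in B(D,\mathbb K)$, $f\in E$ (pointwise product); a BK $b$-ideal is a BK-space that is a $b$-ideal and satisfies $\|b\cdot f\|_E\le\|b\|_{B(D,\mathbb K)}\|f\|_E$ for all such $b,f$. A space $E\subseteq F(D,X)$ does not vanish at any point if for every $a\in D$ there is $f\in E$ with $f(a)\ne0$. $e_a:D\to\mathbb K$ is $1$ at $a$ and $0$ elsewhere; $c_{00}(D,X)$ is the space of functions $D\to X$ that are zero outside a finite set.
   Formalization: In part iii the Banach space X is assumed to be non-zero; for X = {0} the space U_w(D,X) is {0} and vanishes at every point, so the claim as stated fails there. *)

theory Defs
  imports "HOL-Analysis.Analysis" "HOL-Library.Function_Algebras"
begin

(* The scalar field K: up to isometric isomorphism exactly the reals or the complex numbers.
   The norm equation is part of the isomorphism with the complex numbers; on the real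
   alternative it holds automatically. *)
class real_or_complex = real_normed_field +
  assumes real_or_complex:
    "(\<forall>z. \<exists>r. z = r *\<^sub>R 1) \<or>
     (\<exists>j. j * j = - 1 \<and>
        (\<forall>z. \<exists>r s. z = r *\<^sub>R 1 + s *\<^sub>R j \<and> norm z = sqrt (r\<^sup>2 + s\<^sup>2)))"

instance real :: real_or_complex
  by standard (auto intro: exI)

instance complex :: real_or_complex
proof (standard, rule disjI2, intro exI conjI allI)
  show "\<i> * \<i> = - 1"
    by simp
  fix z :: complex
  show "z = Re z *\<^sub>R 1 + Im z *\<^sub>R \<i>"
    by (simp add: complex_eq_iff)
  show "norm z = sqrt ((Re z)\<^sup>2 + (Im z)\<^sup>2)"
    by (simp add: cmod_def)
qed

(* A Banach space X over K. Completeness and the real structure come from the class banach;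
   scl is the multiplication by scalars in K, extending the real one. *)
locale banach_space_over = vector_space scl
  for scl :: "'k::real_or_complex \<Rightarrow> 'x::banach \<Rightarrow> 'x" +
  assumes scl_of_real: "scl (of_real r) x = r *\<^sub>R x"
    and norm_scl: "norm (scl c x) = norm c * norm x"

(* The set D is the (non-empty) type 'd, so F(D,X) is the type 'd => 'x with the pointwise
   operations of Function_Algebras. For X = K, scl is the multiplication of K. *)

definition fun_subspace :: "('k::real_or_complex \<Rightarrow> 'x::real_normed_vector \<Rightarrow> 'x)
    \<Rightarrow> ('d \<Rightarrow> 'x) set \<Rightarrow> bool"
  where "fun_subspace scl E \<longleftrightarrow> module.subspace (\<lambda>c f a. scl c (f a)) E"

(* In the next three definitions only the values of N on E matter. *)

definition norm_on :: "('k::real_or_complex \<Rightarrow> 'x::real_normed_vector \<Rightarrow> 'x)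
    \<Rightarrow> ('d \<Rightarrow> 'x) set \<Rightarrow> (('d \<Rightarrow> 'x) \<Rightarrow> real) \<Rightarrow> bool"
  where "norm_on scl E N \<longleftrightarrow>
    (\<forall>f\<in>E. 0 \<le> N f) \<and>
    (\<forall>f\<in>E. N f = 0 \<longleftrightarrow> f = 0) \<and>
    (\<forall>f\<in>E. \<forall>g\<in>E. N (f + g) \<le> N f + N g) \<and>
    (\<forall>c. \<forall>f\<in>E. N (\<lambda>a. scl c (f a)) = norm c * N f)"

definition complete_norm_on :: "('k::real_or_complex \<Rightarrow> 'x::real_normed_vector \<Rightarrow> 'x)
    \<Rightarrow> ('d \<Rightarrow> 'x) set \<Rightarrow> (('d \<Rightarrow> 'x) \<Rightarrow> real) \<Rightarrow> bool"
  where "complete_norm_on scl E N \<longleftrightarrow> norm_on scl E N \<and>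
    (\<forall>s :: nat \<Rightarrow> 'd \<Rightarrow> 'x.
       (\<forall>n. s n \<in> E) \<and> (\<forall>\<epsilon>>0. \<exists>M. \<forall>m\<ge>M. \<forall>n\<ge>M. N (s m - s n) < \<epsilon>) \<longrightarrow>
       (\<exists>f\<in>E. (\<lambda>n. N (s n - f)) \<longlonglongrightarrow> 0))"

definition BK_space :: "('k::real_or_complex \<Rightarrow> 'x::real_normed_vector \<Rightarrow> 'x)
    \<Rightarrow> ('d \<Rightarrow> 'x) set \<Rightarrow> (('d \<Rightarrow> 'x) \<Rightarrow> real) \<Rightarrow> bool"
  where "BK_space scl E N \<longleftrightarrow> fun_subspace scl E \<and> complete_norm_on scl E N \<and>
    (\<forall>a. \<forall>f\<in>E. \<forall>\<epsilon>>0. \<exists>\<delta>>0. \<forall>g\<in>E. N (g - f) < \<delta> \<longrightarrow> norm (g a - f a) < \<epsilon>)"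

definition bounded_functions :: "('d \<Rightarrow> 'x::real_normed_vector) set"
  where "bounded_functions = {f. bounded (range f)}"

definition sup_norm :: "('d \<Rightarrow> 'x::real_normed_vector) \<Rightarrow> real"
  where "sup_norm f = (SUP a. norm (f a))"

definition order_ideal :: "('d \<Rightarrow> 'k::real_or_complex) set \<Rightarrow> bool"
  where "order_ideal I \<longleftrightarrow> fun_subspace (*) I \<and>
    (\<forall>f. \<forall>g\<in>I. (\<forall>a. norm (f a) \<le> norm (g a)) \<longrightarrow> f \<in> I)"

definition Banach_ideal :: "('d \<Rightarrow> 'k::real_or_complex) set \<Rightarrow> (('d \<Rightarrow> 'k) \<Rightarrow> real) \<Rightarrow> bool"
  where "Banach_ideal I N \<longleftrightarrow> order_ideal I \<and> complete_norm_on (*) I N \<and>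
    (\<forall>f\<in>I. \<forall>g\<in>I. (\<forall>a. norm (f a) \<le> norm (g a)) \<longrightarrow> N f \<le> N g)"

definition b_ideal :: "('k::real_or_complex \<Rightarrow> 'x::real_normed_vector \<Rightarrow> 'x)
    \<Rightarrow> ('d \<Rightarrow> 'x) set \<Rightarrow> bool"
  where "b_ideal scl E \<longleftrightarrow> fun_subspace scl E \<and>
    (\<forall>b\<in>bounded_functions. \<forall>f\<in>E. (\<lambda>a. scl (b a) (f a)) \<in> E)"

definition BK_b_ideal :: "('k::real_or_complex \<Rightarrow> 'x::real_normed_vector \<Rightarrow> 'x)
    \<Rightarrow> ('d \<Rightarrow> 'x) set \<Rightarrow> (('d \<Rightarrow> 'x) \<Rightarrow> real) \<Rightarrow> bool"
  where "BK_b_ideal scl E N \<longleftrightarrow> BK_space scl E N \<and> b_ideal scl E \<and>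
    (\<forall>b\<in>bounded_functions. \<forall>f\<in>E. N (\<lambda>a. scl (b a) (f a)) \<le> sup_norm b * N f)"

definition nowhere_vanishing :: "('d \<Rightarrow> 'x::zero) set \<Rightarrow> bool"
  where "nowhere_vanishing E \<longleftrightarrow> (\<forall>a. \<exists>f\<in>E. f a \<noteq> 0)"

definition finitely_supported :: "('d \<Rightarrow> 'x::zero) set"
  where "finitely_supported = {f. finite {a. f a \<noteq> 0}}"

(* The dual X*: bounded maps linear over K. Its norm is the library's onorm, as the norms of X
   and K are those of the underlying real spaces. *)
definition dual_space :: "('k::real_or_complex \<Rightarrow> 'x::real_normed_vector \<Rightarrow> 'x)
    \<Rightarrow> ('x \<Rightarrow> 'k) set"
  where "dual_space scl = {\<phi>. bounded_linear \<phi> \<and> (\<forall>c x. \<phi> (scl c x) = c * \<phi> x)}"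

definition weak_space :: "('k::real_or_complex \<Rightarrow> 'x::real_normed_vector \<Rightarrow> 'x)
    \<Rightarrow> ('d \<Rightarrow> 'k) set \<Rightarrow> ('d \<Rightarrow> 'x) set"
  where "weak_space scl U = {f. \<forall>\<phi>\<in>dual_space scl. \<phi> \<circ> f \<in> U}"

definition weak_norm_values :: "('k::real_or_complex \<Rightarrow> 'x::real_normed_vector \<Rightarrow> 'x)
    \<Rightarrow> (('d \<Rightarrow> 'k) \<Rightarrow> real) \<Rightarrow> ('d \<Rightarrow> 'x) \<Rightarrow> real set"
  where "weak_norm_values scl N f = {N (\<phi> \<circ> f) | \<phi>. \<phi> \<in> dual_space scl \<and> onorm \<phi> \<le> 1}"

(* A supremum of reals is meaningful only for bounded sets; that weak_norm_values is bounded
   above on the weak space is to be asserted separately. *)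
definition weak_norm :: "('k::real_or_complex \<Rightarrow> 'x::real_normed_vector \<Rightarrow> 'x)
    \<Rightarrow> (('d \<Rightarrow> 'k) \<Rightarrow> real) \<Rightarrow> ('d \<Rightarrow> 'x) \<Rightarrow> real"
  where "weak_norm scl N f = Sup (weak_norm_values scl N f)"

end

theory Submission
  imports Defs
begin

text \<open>Composition with \<open>f \<in> U\<^sub>w(D,X)\<close> is a linear map from \<open>X\<^sup>*\<close> to \<open>U\<close> whose graph is closed, since the
  evaluations on \<open>U\<close> are continuous; the closed graph theorem therefore makes the weak norm finite.
  By Hahn-Banach the functionals of norm at most 1 recover the norm of \<open>X\<close>, which bounds the
  evaluations on \<open>U\<^sub>w(D,X)\<close> by the weak norm. So a weakly Cauchy sequence converges pointwise, and its
  compositions with functionals converge in \<open>U\<close> to those of the pointwise limit. The boundedness in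
  (v) is the uniform boundedness principle.\<close>

section \<open>The Hahn-Banach theorem\<close>

text \<open>The norm \<open>N\<close> is a function on a set, not the norm of a type, so theorems
  about Banach spaces as types do not apply to \<open>U\<close>. Baire's theorem is therefore used
  only in the domain, and completeness of \<open>U\<close> enters through limits of
  \<open>N\<close>-Cauchy sequences. The domain must in turn be a complete type: the functionals
  over \<open>'k\<close> form merely a set, whereas the bounded real functionals are the type
  \<open>'x \<Rightarrow>\<^sub>L real\<close>. Taking real parts matches the two isometrically, so
  a bound over the real functionals passes to the unit ball of the dual space. Hahn-Banach is
  obtained without extending anything from a subspace: a minimal sublinear functional is linear, and
  one decrease in a chosen direction before minimizing fixes the value at a given point. A single
  Baire argument on symmetric convex covers serves both the closed graph theorem and uniform
  boundedness.\<close>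

definition sublinear :: "('a::real_vector \<Rightarrow> real) \<Rightarrow> bool"
  where "sublinear q \<longleftrightarrow>
    (\<forall>x y. q (x + y) \<le> q x + q y) \<and> (\<forall>r x. 0 \<le> r \<longrightarrow> q (r *\<^sub>R x) = r * q x)"

lemma sublinear_add: "sublinear q \<Longrightarrow> q (x + y) \<le> q x + q y"
  and sublinear_scaleR: "sublinear q \<Longrightarrow> 0 \<le> r \<Longrightarrow> q (r *\<^sub>R x) = r * q x"
  by (auto simp: sublinear_def)

lemma sublinear_0: "sublinear q \<Longrightarrow> q 0 = 0"
  using sublinear_scaleR[of q 0 0] by simp

lemma sublinear_minus_ge: "sublinear q \<Longrightarrow> - q (- x) \<le> q x"
  using sublinear_add[of q x "- x"] sublinear_0[of q] by simp

text \<open>One inequality suffices for homogeneity: used with \<open>inverse r\<close> at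
  \<open>r *\<^sub>R x\<close>, it yields the opposite one.\<close>

lemma sublinearI:
  assumes add: "\<And>x y. q (x + y) \<le> q x + q y"
    and zero: "q 0 = 0"
    and scale: "\<And>r x. 0 < r \<Longrightarrow> q (r *\<^sub>R x) \<le> r * q x"
  shows "sublinear q"
proof -
  have "q (r *\<^sub>R x) = r * q x" if "0 \<le> r" for r x
  proof (cases "r = 0")
    case False
    with that have r: "0 < r" by simp
    have "q x \<le> inverse r * q (r *\<^sub>R x)"
      using scale[of "inverse r" "r *\<^sub>R x"] r by simp
    then have "r * q x \<le> q (r *\<^sub>R x)"
      using r by (simp add: field_simps)
    with scale[OF r, of x] show ?thesis by simp
  qed (simp add: zero)
  with add show ?thesis by (auto simp: sublinear_def)
qed

text \<open>Hence a minimal sublinear functional is odd and therefore linear.\<close>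

lemma sublinear_decrease:
  assumes q: "sublinear q"
  obtains s where "sublinear s" "\<And>y. s y \<le> q y" "s (- x) \<le> - q x"
proof -
  \<comment> \<open>Each unit of translation along \<open>x\<close> is paid for by
    \<open>q x\<close>. In the infimum, \<open>t = 0\<close> gives \<open>s \<le> q\<close>, and
    \<open>t = 1\<close> at \<open>- x\<close> gives \<open>q 0 - q x = - q x\<close>.\<close>
  define h where "h y t = q (y + t *\<^sub>R x) - t * q x" for y t
  define s where "s y = (INF t\<in>{0..}. h y t)" for y
  \<comment> \<open>This bound does not depend on \<open>t\<close>, so the infimum defining
    \<open>s\<close> is finite.\<close>
  have lb: "- q (- y) \<le> h y t" if "0 \<le> t" for y t
  proof -
    have "t * q x = q ((y + t *\<^sub>R x) + (- y))"
      using sublinear_scaleR[OF q that] by simp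
    also have "\<dots> \<le> q (y + t *\<^sub>R x) + q (- y)"
      by (rule sublinear_add[OF q])
    finally show ?thesis by (simp add: h_def)
  qed
  have s_le: "s y \<le> h y t" if "0 \<le> t" for y t
    unfolding s_def using that lb by (intro cINF_lower bdd_belowI2[of _ "- q (- y)"]) auto
  have s_ge: "c \<le> s y" if "\<And>t. 0 \<le> t \<Longrightarrow> c \<le> h y t" for c y
    unfolding s_def using that by (intro cINF_greatest) auto
  show ?thesis
  proof
    show "sublinear s"
    proof (rule sublinearI)
      fix y z
      have *: "s (y + z) \<le> h y t + h z u" if "0 \<le> t" "0 \<le> u" for t u
      proof -
        have "s (y + z) \<le> h (y + z) (t + u)"
          using that by (intro s_le) simp
        also have "\<dots> \<le> h y t + h z u"
          using sublinear_add[OF q, of "y + t *\<^sub>R x" "z + u *\<^sub>R x"]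
          by (simp add: h_def algebra_simps)
        finally show ?thesis .
      qed
      have "s (y + z) - h z u \<le> s y" if "0 \<le> u" for u
        by (rule s_ge) (use * that in \<open>simp add: algebra_simps\<close>)
      then have "s (y + z) - s y \<le> s z"
        by (intro s_ge) (simp add: algebra_simps)
      then show "s (y + z) \<le> s y + s z" by simp
    next
      show "s 0 = 0"
      proof (rule antisym)
        show "s 0 \<le> 0"
          using s_le[of 0 0] by (simp add: h_def sublinear_0[OF q])
        show "0 \<le> s 0"
          by (rule s_ge) (simp add: h_def sublinear_scaleR[OF q])
      qed
    next
      fix r :: real and y
      assume r: "0 < r"
      have "inverse r * s (r *\<^sub>R y) \<le> s y"
      proof (rule s_ge)
        fix t :: real assume "0 \<le> t"
        with r have "s (r *\<^sub>R y) \<le> h (r *\<^sub>R y) (r * t)"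
          by (intro s_le) simp
        also have "\<dots> = r * h y t"
          using sublinear_scaleR[OF q, of r "y + t *\<^sub>R x"] r
          by (simp add: h_def algebra_simps)
        finally show "inverse r * s (r *\<^sub>R y) \<le> h y t"
          using r by (simp add: field_simps)
      qed
      then show "s (r *\<^sub>R y) \<le> r * s y"
        using r by (simp add: field_simps)
    qed
    show "s y \<le> q y" for y
      using s_le[of 0 y] by (simp add: h_def)
    show "s (- x) \<le> - q x"
      using s_le[of 1 "- x"] by (simp add: h_def sublinear_0[OF q])
  qed
qed

text \<open>The pointwise infimum works. Subadditivity is where the chain matters: for
  \<open>q\<close> and \<open>r\<close> taken at different points, one of them lies below both and
  can replace the pair. The bound \<open>p\<close> keeps the infimum finite, as
  \<open>- p (- x) \<le> - r (- x) \<le> r x\<close>.\<close>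

lemma sublinear_chain_lower_bound:
  assumes ne: "C \<noteq> {}"
    and C: "\<And>q. q \<in> C \<Longrightarrow> sublinear q" "\<And>q x. q \<in> C \<Longrightarrow> q x \<le> p x"
    and chain: "\<And>q r. q \<in> C \<Longrightarrow> r \<in> C \<Longrightarrow> q \<le> r \<or> r \<le> q"
  obtains u where "sublinear u" "\<And>q x. q \<in> C \<Longrightarrow> u x \<le> q x"
proof -
  define u where "u x = (INF q\<in>C. q x)" for x
  have u_le: "u x \<le> q x" if "q \<in> C" for q x
    unfolding u_def
  proof (rule cINF_lower[OF bdd_belowI2 that])
    fix r assume "r \<in> C"
    with sublinear_minus_ge[of r x] C show "- p (- x) \<le> r x"
      by (smt (verit))
  qed
  have u_ge: "c \<le> u x" if "\<And>q. q \<in> C \<Longrightarrow> c \<le> q x" for c x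
    unfolding u_def using that by (intro cINF_greatest ne)
  have "sublinear u"
  proof (rule sublinearI)
    fix x y
    have *: "u (x + y) \<le> q x + r y" if qr: "q \<in> C" "r \<in> C" for q r
    proof -
      obtain m where "m \<in> C" "m \<le> q" "m \<le> r"
        using chain[OF qr] qr by auto
      then show ?thesis
        using u_le[of m "x + y"] sublinear_add[OF C(1), of m x y]
          le_funD[of m q x] le_funD[of m r y] by linarith
    qed
    have "u (x + y) - r y \<le> u x" if "r \<in> C" for r
      by (rule u_ge) (use * that in \<open>simp add: algebra_simps\<close>)
    then have "u (x + y) - u x \<le> u y"
      by (intro u_ge) (simp add: algebra_simps)
    then show "u (x + y) \<le> u x + u y" by simp
  next
    show "u 0 = 0"
      unfolding u_def using ne by (simp add: sublinear_0 C(1) cong: INF_cong)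
  next
    fix r :: real and x
    assume r: "0 < r"
    have "inverse r * u (r *\<^sub>R x) \<le> u x"
    proof (rule u_ge)
      fix q assume "q \<in> C"
      then show "inverse r * u (r *\<^sub>R x) \<le> q x"
        using u_le[of q "r *\<^sub>R x"] sublinear_scaleR[OF C(1), of q r x] r
        by (simp add: field_simps)
    qed
    then show "u (r *\<^sub>R x) \<le> r * u x"
      using r by (simp add: field_simps)
  qed
  then show ?thesis using u_le that by blast
qed

lemma linear_below_sublinear:
  assumes p: "sublinear p"
  obtains f where "linear f" "\<And>x. f x \<le> p x"
proof -
  define A where "A = {q. sublinear q \<and> q \<le> p}"
  have "\<exists>m\<in>A. \<forall>q\<in>A. q \<le> m \<longrightarrow> q = m"
  \<comment> \<open>The order is reversed, so the maximal element supplied by Zorn's lemma is a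
    minimal sublinear functional, and upper bounds of chains are pointwise lower bounds.\<close>
  proof (rule predicate_Zorn[of A "\<lambda>q r. r \<le> q"])
    show "partial_order_on A (relation_of (\<lambda>q r. r \<le> q) A)"
      by (rule partial_order_on_relation_ofI) auto
    fix C assume "C \<in> Chains (relation_of (\<lambda>q r. r \<le> q) A)"
    then have C: "C \<subseteq> A" "\<And>q r. q \<in> C \<Longrightarrow> r \<in> C \<Longrightarrow> q \<le> r \<or> r \<le> q"
      by (auto simp: Chains_def relation_of_def)
    show "\<exists>u\<in>A. \<forall>q\<in>C. u \<le> q"
    proof (cases "C = {}")
      case True
      then show ?thesis using p by (auto simp: A_def)
    next
      case False
      obtain u where u: "sublinear u" "\<And>q x. q \<in> C \<Longrightarrow> u x \<le> q x"
        by (rule sublinear_chain_lower_bound[of C p]) (use False C in \<open>auto simp: A_def le_fun_def\<close>)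
      moreover obtain q where "q \<in> C" "q \<le> p"
        using False C(1) by (auto simp: A_def)
      ultimately have "u \<le> p"
        by (meson le_fun_def order_trans)
      with u show ?thesis
        by (auto simp: A_def le_fun_def)
    qed
  qed
  then obtain m where m: "sublinear m" "m \<le> p" and min: "\<And>q. q \<in> A \<Longrightarrow> q \<le> m \<Longrightarrow> q = m"
    by (auto simp: A_def)
  \<comment> \<open>Minimality forces the decreased functional \<open>s\<close> to equal
    \<open>m\<close>, which turns its value at \<open>- x\<close> into the missing half of
    oddness.\<close>
  have minus: "m (- x) = - m x" for x
  proof -
    obtain s where s: "sublinear s" "\<And>y. s y \<le> m y" "s (- x) \<le> - m x"
      using sublinear_decrease[OF m(1)] by blast
    then have "s \<le> m" by (simp add: le_fun_def)
    with s(1) m(2) have "s = m"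
      by (intro min) (auto simp: A_def)
    with s(3) sublinear_minus_ge[OF m(1), of "x"] show ?thesis by simp
  qed
  have "linear m"
  proof (rule linearI)
    fix x y
    show "m (x + y) = m x + m y"
      using sublinear_add[OF m(1), of x y] sublinear_add[OF m(1), of "x + y" "- y"]
      by (simp add: minus)
  next
    fix r x
    show "m (r *\<^sub>R x) = r *\<^sub>R m x"
    proof (cases "0 \<le> r")
      case False
      then show ?thesis
        using sublinear_scaleR[OF m(1), of "- r" x] by (simp add: minus)
    qed (simp add: sublinear_scaleR[OF m(1)])
  qed
  with m(2) show ?thesis using that by (auto simp: le_fun_def)
qed

text \<open>Any linear \<open>f\<close> below the decreased functional \<open>s\<close> satisfies
  \<open>- f x = f (- x) \<le> s (- x) \<le> - p x\<close>, so it attains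
  \<open>p x\<close>.\<close>

lemma Hahn_Banach_sublinear:
  assumes p: "sublinear p"
  obtains f where "linear f" "\<And>y. f y \<le> p y" "f x = p x"
proof -
  obtain s where s: "sublinear s" "\<And>y. s y \<le> p y" "s (- x) \<le> - p x"
    using sublinear_decrease[OF p] by blast
  obtain f where f: "linear f" "\<And>y. f y \<le> s y"
    using linear_below_sublinear[OF s(1)] by blast
  have "p x \<le> f x"
    using f(2)[of "- x"] s(3) linear_neg[OF f(1), of x] by simp
  moreover have "f y \<le> p y" for y
    using f(2) s(2) order_trans by blast
  ultimately show ?thesis
    using f(1) that antisym by metis
qed

lemma norming_functional:
  fixes x :: "'a::real_normed_vector"
  obtains \<psi> :: "'a \<Rightarrow>\<^sub>L real" where "norm \<psi> \<le> 1" "\<psi> x = norm x"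
proof -
  have "sublinear (norm :: 'a \<Rightarrow> real)"
    by (auto simp: sublinear_def norm_triangle_ineq)
  then obtain f where f: "linear f" "\<And>y. f y \<le> norm y" "f x = norm x"
    by (rule Hahn_Banach_sublinear) blast
  have abs: "\<bar>f y\<bar> \<le> norm y" for y
    using f(2)[of y] f(2)[of "- y"] linear_neg[OF f(1), of y] by simp
  have "bounded_linear f"
    using f(1) abs by (intro bounded_linear_intro[where K=1]) (simp_all add: linear_add linear_scale)
  then have "blinfun_apply (Blinfun f) = f"
    by (rule bounded_linear_Blinfun_apply)
  with f(3) abs show ?thesis
    by (intro that[of "Blinfun f"] norm_blinfun_bound) auto
qed

section \<open>The closed graph theorem for BK-spaces\<close>

text \<open>Baire's theorem places a ball in some closure, but around an unknown centre. Symmetry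
  and convexity, both inherited by the closure, move that ball to the origin.\<close>

lemma Baire_symmetric_convex_cover:
  fixes A :: "nat \<Rightarrow> 'a::banach set"
  assumes cover: "(\<Union>n. A n) = UNIV"
    and convex: "\<And>n. convex (A n)"
    and sym: "\<And>n x. x \<in> A n \<Longrightarrow> - x \<in> A n"
  obtains n r where "0 < r" "ball 0 r \<subseteq> closure (A n)"
proof -
  have "\<exists>n. interior (closure (A n)) \<noteq> {}"
  proof (rule ccontr)
    assume *: "\<not> ?thesis"
    have "euclidean interior_of (\<Union>n. closure (A n)) = {}"
    proof (rule Baire_category_alt)
      show "countable (range (\<lambda>n. closure (A n)))" by simp
      fix T assume "T \<in> range (\<lambda>n. closure (A n))"
      with * show "closedin euclidean T \<and> euclidean interior_of T = {}" by auto
    qed (simp add: completely_metrizable_space_euclidean)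
    moreover have "(\<Union>n. A n) \<subseteq> (\<Union>n. closure (A n))"
      by (intro UN_mono closure_subset order_refl)
    ultimately show False
      using cover by (simp add: top.extremum_unique)
  qed
  then obtain n x where "x \<in> interior (closure (A n))" by blast
  then obtain r where r: "0 < r" "ball x r \<subseteq> closure (A n)"
    using mem_interior by blast
  have sym': "- y \<in> closure (A n)" if "y \<in> closure (A n)" for y
  proof -
    have "closure (A n) \<subseteq> uminus -` closure (A n)"
    proof (rule closure_minimal)
      show "A n \<subseteq> uminus -` closure (A n)"
        using sym closure_subset by blast
      show "closed (uminus -` closure (A n))"
        by (intro closed_vimage continuous_intros) simp
    qed
    with that show ?thesis by auto
  qed
  have "y \<in> closure (A n)" if "y \<in> ball 0 r" for y
  proof -
    have "x + y \<in> closure (A n)" "x - y \<in> closure (A n)"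
      using r(2) that by (auto simp: subset_iff dist_norm)
    \<comment> \<open>The point \<open>y\<close> is the midpoint of \<open>x + y\<close> and the
      reflection of \<open>x - y\<close>.\<close>
    then have "(1/2) *\<^sub>R (x + y) + (1/2) *\<^sub>R (- (x - y)) \<in> closure (A n)"
      by (intro convexD[OF convex_closure[OF convex]] sym') auto
    moreover have "(1/2) *\<^sub>R (x + y) + (1/2) *\<^sub>R (- (x - y)) = y"
      by (simp flip: scaleR_right_distrib)
    ultimately show ?thesis by simp
  qed
  then show ?thesis using r(1) that by blast
qed

section \<open>Norm estimates and evaluations in a scalar BK-space\<close>

lemma module_scalar_functions: "module (\<lambda>c f a. c * f a :: 'k::real_or_complex)"
  by standard (auto simp: fun_eq_iff algebra_simps)

locale scalar_BK_space =
  fixes U :: "('d \<Rightarrow> 'k::real_or_complex) set"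
    and N :: "('d \<Rightarrow> 'k) \<Rightarrow> real"
  assumes BK: "BK_space (*) U N"
begin

lemma subspace_U: "module.subspace (\<lambda>c f a. c * f a) U"
  using BK by (auto simp: BK_space_def fun_subspace_def)

lemmas zero_mem = module.subspace_0[OF module_scalar_functions subspace_U]
  and add_mem = module.subspace_add[OF module_scalar_functions subspace_U]
  and diff_mem = module.subspace_diff[OF module_scalar_functions subspace_U]
  and scale_mem = module.subspace_scale[OF module_scalar_functions subspace_U]
  and sum_mem = module.subspace_sum[OF module_scalar_functions subspace_U]

lemma norm_on_U: "norm_on (*) U N"
  using BK by (simp add: BK_space_def complete_norm_on_def)

lemma N_nonneg: "f \<in> U \<Longrightarrow> 0 \<le> N f"
  and N_eq_0_iff: "f \<in> U \<Longrightarrow> N f = 0 \<longleftrightarrow> f = 0"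
  and N_add: "f \<in> U \<Longrightarrow> g \<in> U \<Longrightarrow> N (f + g) \<le> N f + N g"
  and N_scale: "f \<in> U \<Longrightarrow> N (\<lambda>a. c * f a) = norm c * N f"
  using norm_on_U by (auto simp: norm_on_def)

lemma N_minus: "f \<in> U \<Longrightarrow> N (- f) = N f"
  using N_scale[of f "- 1"] by (simp add: fun_Compl_def)

lemma N_diff_triangle:
  assumes "f \<in> U" "g \<in> U" "h \<in> U"
  shows "N (f - h) \<le> N (f - g) + N (g - h)"
  using N_add[of "f - g" "g - h"] assms diff_mem by simp

lemma N_diff_commute: "f \<in> U \<Longrightarrow> g \<in> U \<Longrightarrow> N (f - g) = N (g - f)"
  using N_minus[of "f - g"] diff_mem by simp

lemma N_Cauchy_convergent:
  assumes "\<And>n. s n \<in> U" "\<And>\<epsilon>. 0 < \<epsilon> \<Longrightarrow> \<exists>M. \<forall>m\<ge>M. \<forall>n\<ge>M. N (s m - s n) < \<epsilon>"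
  obtains u where "u \<in> U" "(\<lambda>n. N (s n - u)) \<longlonglongrightarrow> 0"
  using BK assms unfolding BK_space_def complete_norm_on_def by metis

text \<open>Continuity at \<open>0\<close> alone gives a linear bound by homogeneity:
  \<open>f\<close> is rescaled to norm \<open>\<delta> / 2\<close>, strictly inside the
  neighbourhood where evaluation is below 1.\<close>

lemma evaluation_bound:
  obtains C where "0 \<le> C" "\<And>f. f \<in> U \<Longrightarrow> norm (f a) \<le> C * N f"
proof -
  obtain \<delta> where \<delta>: "0 < \<delta>" "\<And>g. g \<in> U \<Longrightarrow> N g < \<delta> \<Longrightarrow> norm (g a) < 1"
    using BK zero_mem unfolding BK_space_def
    by (metis diff_zero zero_fun_apply zero_less_one)
  have "norm (f a) \<le> 2 / \<delta> * N f" if f: "f \<in> U" for f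
  proof (cases "N f = 0")
    case True
    then show ?thesis using N_eq_0_iff[OF f] by simp
  next
    case False
    define r where "r = \<delta> / (2 * N f)"
    have Nf: "0 < N f" using False N_nonneg[OF f] by simp
    then have r: "0 < r" using \<delta>(1) by (simp add: r_def)
    have "N (\<lambda>a. of_real r * f a) = \<delta> / 2"
      unfolding N_scale[OF f] norm_of_real using Nf \<delta>(1) by (simp add: r_def)
    then have "norm (of_real r * f a) < 1"
      using \<delta>(1) by (intro \<delta>(2) scale_mem[OF f]) simp
    then have "r * norm (f a) < 1"
      using r by (simp add: norm_mult)
    then show ?thesis
      using Nf \<delta>(1) by (simp add: r_def field_simps)
  qed
  then show ?thesis
    using \<delta>(1) by (intro that[of "2 / \<delta>"]) auto
qed

lemma tendsto_evaluation:
  assumes "\<And>n. s n \<in> U" "u \<in> U" "(\<lambda>n. N (s n - u)) \<longlonglongrightarrow> 0"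
  shows "(\<lambda>n. s n a) \<longlonglongrightarrow> u a"
proof -
  obtain C where C: "\<And>f. f \<in> U \<Longrightarrow> norm (f a) \<le> C * N f"
    using evaluation_bound by blast
  have "(\<lambda>n. C * N (s n - u)) \<longlonglongrightarrow> 0"
    using tendsto_mult_right_zero[OF assms(3)] .
  moreover have "norm (s n a - u a) \<le> C * N (s n - u)" for n
    using C[of "s n - u"] diff_mem assms by simp
  ultimately have "(\<lambda>n. s n a - u a) \<longlonglongrightarrow> 0"
    by (intro Lim_null_comparison[of "\<lambda>n. s n a - u a"]) auto
  then show ?thesis by (simp add: LIM_zero_iff)
qed

text \<open>Successive approximation of \<open>x\<close>: the images of the partial sums are Cauchy for \<open>N\<close>, and the
  evaluations identify their limit as \<open>T x\<close>.\<close>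

lemma bounded_of_approximable:
  fixes T :: "'e::banach \<Rightarrow> 'd \<Rightarrow> 'k"
  assumes TU: "\<And>x. T x \<in> U"
    and T: "\<And>a. bounded_linear (\<lambda>x. T x a)"
    and r: "0 < r"
    and approx: "\<And>k x. norm x < r / 2 ^ k \<Longrightarrow>
      \<exists>y. N (T y) \<le> c / 2 ^ k \<and> norm (x - y) < r / 2 ^ Suc k"
    and x: "norm x < r"
  shows "N (T x) \<le> 2 * c"
proof -
  have T_diff: "T (y - z) = T y - T z" for y z
    using linear_diff[OF bounded_linear.linear[OF T]] by (auto simp: fun_eq_iff)
  obtain z where z0: "z 0 = x" and z: "\<And>k. norm (z k) < r / 2 ^ k"
    and Nz: "\<And>k. N (T (z k - z (Suc k))) \<le> c / 2 ^ k"
  proof -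
    \<comment> \<open>Here \<open>z k\<close> is the remainder after \<open>k\<close>
      approximations. Dependent choice constrains the first term only by the invariant, hence the
      clause for \<open>k = 0\<close>.\<close>
    have "\<exists>z. \<forall>k. (norm (z k) < r / 2 ^ k \<and> (k = 0 \<longrightarrow> z k = x)) \<and>
      N (T (z k - z (Suc k))) \<le> c / 2 ^ k"
    proof (rule dependent_nat_choice)
      fix w k assume "norm w < r / 2 ^ k \<and> (k = 0 \<longrightarrow> w = x)"
      then obtain y where "N (T y) \<le> c / 2 ^ k" "norm (w - y) < r / 2 ^ Suc k"
        using approx by blast
      then show "\<exists>v. (norm v < r / 2 ^ Suc k \<and> (Suc k = 0 \<longrightarrow> v = x)) \<and> N (T (w - v)) \<le> c / 2 ^ k"
        by (intro exI[of _ "w - y"]) simp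
    qed (use x in auto)
    then show ?thesis using that by blast
  qed
  define s where "s k = T (x - z k)" for k
  have sU: "s k \<in> U" for k by (simp add: s_def TU)
  have step: "N (s (Suc k) - s k) \<le> c / 2 ^ k" for k
    using Nz[of k] by (simp add: s_def flip: T_diff)
  have c: "0 \<le> c"
    using Nz[of 0] N_nonneg[OF TU, of "z 0 - z 1"] by simp
  \<comment> \<open>The factor \<open>2 - 2 / 2 ^ m\<close> is the geometric sum of
    \<open>1 / 2 ^ i\<close> over \<open>i < m\<close>; the exact value makes the induction
    close.\<close>
  have tail: "N (s (k + m) - s k) \<le> c / 2 ^ k * (2 - 2 / 2 ^ m)" for k m
  proof (induction m)
    case 0
    then show ?case using N_eq_0_iff[OF zero_mem] by (simp add: zero_fun_def)
  next
    case (Suc m)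
    have "N (s (k + Suc m) - s k) \<le> N (s (Suc (k + m)) - s (k + m)) + N (s (k + m) - s k)"
      using N_diff_triangle[OF sU sU sU] by simp
    also have "\<dots> \<le> c / 2 ^ (k + m) + c / 2 ^ k * (2 - 2 / 2 ^ m)"
      by (intro add_mono step Suc)
    also have "\<dots> = c / 2 ^ k * (2 - 2 / 2 ^ Suc m)"
      by (simp add: power_add field_simps)
    finally show ?case .
  qed
  have tail': "N (s n - s k) \<le> 2 * c / 2 ^ k" if "k \<le> n" for k n
  proof -
    have "N (s n - s k) \<le> c / 2 ^ k * (2 - 2 / 2 ^ (n - k))"
      using tail[of k "n - k"] that by simp
    also have "\<dots> \<le> c / 2 ^ k * 2"
      using c by (intro mult_left_mono) auto
    finally show ?thesis by (simp add: mult.commute)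
  qed
  have lim0: "(\<lambda>k. C / 2 ^ k) \<longlonglongrightarrow> 0" for C :: real
    using tendsto_mult_right_zero[OF LIMSEQ_inverse_realpow_zero, of 2 C] by (simp add: divide_inverse)
  obtain u where u: "u \<in> U" "(\<lambda>n. N (s n - u)) \<longlonglongrightarrow> 0"
  proof (rule N_Cauchy_convergent[of s])
    fix \<epsilon> :: real assume "0 < \<epsilon>"
    then obtain M where M: "2 * c / 2 ^ M < \<epsilon> / 2"
      using order_tendstoD(2)[OF lim0, of "\<epsilon> / 2" "2 * c"]
      by (auto simp: eventually_sequentially)
    have "N (s m - s n) < \<epsilon>" if "M \<le> m" "M \<le> n" for m n
      using N_diff_triangle[OF sU[of m] sU[of M] sU[of n]] N_diff_commute[OF sU sU, of M n]
        tail'[OF that(1)] tail'[OF that(2)] M by linarith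
    then show "\<exists>M. \<forall>m\<ge>M. \<forall>n\<ge>M. N (s m - s n) < \<epsilon>" by blast
  qed (use sU in auto)
  have "u = T x"
  proof
    fix a
    have "z \<longlonglongrightarrow> 0"
      by (rule Lim_null_comparison[OF _ lim0[of r]]) (use z in \<open>auto intro!: always_eventually less_imp_le\<close>)
    then have "(\<lambda>k. T (x - z k) a) \<longlonglongrightarrow> T (x - 0) a"
      by (intro bounded_linear.tendsto[OF T] tendsto_intros)
    moreover have "(\<lambda>k. T (x - z k) a) \<longlonglongrightarrow> u a"
      using tendsto_evaluation[OF sU u] by (simp add: s_def)
    ultimately show "u a = T x a"
      using LIMSEQ_unique by fastforce
  qed
  \<comment> \<open>Since \<open>z 0 = x\<close>, the sequence \<open>s\<close> starts at
    \<open>0\<close>, and the tail estimate from index 0 bounds every \<open>N (s n)\<close> by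
    \<open>2 * c\<close>. The extra term vanishes in the limit.\<close>
  have "N (T x) \<le> N (s n - u) + 2 * c" for n
  proof -
    have "s 0 = 0" using T_diff[of x x] by (simp add: s_def z0)
    with tail'[of 0 n] have "N (s n) \<le> 2 * c" by simp
    then show ?thesis
      using N_diff_triangle[OF u(1) sU zero_mem, of n] N_diff_commute[OF u(1) sU, of n] \<open>u = T x\<close>
      by simp
  qed
  moreover have "(\<lambda>n. N (s n - u) + 2 * c) \<longlonglongrightarrow> 0 + 2 * c"
    by (intro tendsto_intros u)
  ultimately show ?thesis
    using LIMSEQ_le_const by fastforce
qed

text \<open>The sublevel sets of \<open>N (T x)\<close> are convex, symmetric and cover the domain,
  but need not be closed, so Baire's theorem only shows that one of them is dense in a ball.
  Successive approximation removes the closure at the cost of a factor 2.\<close>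

lemma closed_graph_bound:
  fixes T :: "'e::banach \<Rightarrow> 'd \<Rightarrow> 'k"
  assumes TU: "\<And>x. T x \<in> U"
    and T: "\<And>a. bounded_linear (\<lambda>x. T x a)"
  obtains C where "0 \<le> C" "\<And>x. N (T x) \<le> C * norm x"
proof -
  interpret T: bounded_linear "\<lambda>x. T x a" for a by (rule T)
  have T_add: "T (x + y) = T x + T y" for x y
    by (simp add: fun_eq_iff T.add)
  have T_scaleR: "N (T (t *\<^sub>R x)) = \<bar>t\<bar> * N (T x)" for t x
  proof -
    have "T (t *\<^sub>R x) = (\<lambda>a. of_real t * T x a)"
      by (rule ext) (simp only: T.scaleR scaleR_conv_of_real)
    then show ?thesis
      by (simp only: N_scale[OF TU] norm_of_real)
  qed
  define A where "A n = {x. N (T x) \<le> real n}" for n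
  obtain n r where r: "0 < r" "ball 0 r \<subseteq> closure (A n)"
  proof (rule Baire_symmetric_convex_cover[of A])
    show "(\<Union>n. A n) = UNIV"
      using real_arch_simple by (auto simp: A_def)
    show "convex (A n)" for n
    proof (rule convexI)
      fix x y and u v :: real
      assume xy: "x \<in> A n" "y \<in> A n" and uv: "0 \<le> u" "0 \<le> v" "u + v = 1"
      have "N (T (u *\<^sub>R x + v *\<^sub>R y)) \<le> u * N (T x) + v * N (T y)"
        using N_add[OF TU TU, of "u *\<^sub>R x" "v *\<^sub>R y"] uv by (simp add: T_add T_scaleR)
      also have "\<dots> \<le> u * n + v * n"
        using xy uv by (intro add_mono mult_left_mono) (auto simp: A_def)
      finally show "u *\<^sub>R x + v *\<^sub>R y \<in> A n"
        using uv by (simp add: A_def flip: distrib_right)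
    qed
    show "- x \<in> A n" if "x \<in> A n" for n x
      using that T_scaleR[of "- 1" x] by (simp add: A_def)
  qed
  have approx: "\<exists>y. N (T y) \<le> real n / 2 ^ k \<and> norm (x - y) < r / 2 ^ Suc k"
    if "norm x < r / 2 ^ k" for k x
  proof -
    \<comment> \<open>Density is known at scale \<open>r\<close> only. Blowing \<open>x\<close> up
      by \<open>2 ^ k\<close>, approximating within \<open>r / 2\<close> and shrinking back halves
      the remainder and divides the bound \<open>n\<close> by \<open>2 ^ k\<close>.\<close>
    have "2 ^ k *\<^sub>R x \<in> closure (A n)"
      using that r(2) by (auto simp: field_simps)
    then obtain y where y: "y \<in> A n" "dist y (2 ^ k *\<^sub>R x) < r / 2"
      using r(1) by (meson closure_approachable half_gt_zero)
    define w where "w = (1 / 2 ^ k) *\<^sub>R y"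
    have "norm (x - w) = norm ((1 / 2 ^ k) *\<^sub>R (2 ^ k *\<^sub>R x - y))"
      by (simp add: w_def algebra_simps)
    also have "\<dots> = norm (2 ^ k *\<^sub>R x - y) / 2 ^ k"
      by (simp only: norm_scaleR) simp
    also have "\<dots> < r / 2 / 2 ^ k"
      using y(2) by (intro divide_strict_right_mono) (auto simp: dist_norm norm_minus_commute)
    finally have "norm (x - w) < r / 2 ^ Suc k"
      by simp
    moreover have "N (T w) \<le> real n / 2 ^ k"
      using y(1) by (simp add: w_def T_scaleR A_def divide_right_mono)
    ultimately show ?thesis by blast
  qed
  have "N (T x) \<le> 4 * real n / r * norm x" for x
  proof (cases "x = 0")
    case True
    then show ?thesis using T_scaleR[of 0 x] by simp
  next
    case False
    \<comment> \<open>This puts \<open>t *\<^sub>R x\<close> at norm \<open>r / 2\<close>, inside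
      the open ball; the bound \<open>2 * n\<close> there becomes the constant
      \<open>4 * n / r\<close>.\<close>
    define t where "t = r / (2 * norm x)"
    have t: "0 < t" using False r(1) by (simp add: t_def)
    have "norm (t *\<^sub>R x) < r" using False r(1) by (simp add: t_def)
    then have "N (T (t *\<^sub>R x)) \<le> 2 * real n"
      by (intro bounded_of_approximable[OF TU T r(1) approx])
    then have "t * N (T x) \<le> 2 * real n"
      using t by (simp add: T_scaleR)
    then show ?thesis
      using False r(1) by (simp add: t_def field_simps)
  qed
  then show ?thesis
    using r(1) by (intro that[of "4 * real n / r"]) auto
qed

end

section \<open>The dual space\<close>

text \<open>The element \<open>j\<close> is the imaginary unit over the complex numbers and \<open>0\<close> over the reals.\<close>

lemma scalar_decomposition:
  obtains re :: "'k::real_or_complex \<Rightarrow> real" and j :: 'k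
  where "linear re" "\<And>z. \<bar>re z\<bar> \<le> norm z" "\<And>r. re (of_real r) = r" "\<And>r. re (of_real r * j) = 0"
    "\<And>z. z = of_real (re z) - of_real (re (j * z)) * j" "j = 0 \<or> j * j = - 1"
proof -
  consider (real) "\<forall>z::'k. \<exists>r. z = of_real r"
    | (complex) i :: 'k where "i * i = - 1"
      "\<forall>z. \<exists>r s. z = of_real r + of_real s * i \<and> norm z = sqrt (r\<^sup>2 + s\<^sup>2)"
    using real_or_complex[where 'a='k] by (auto simp: scaleR_conv_of_real)
  then show ?thesis
  proof cases
    case real
    then obtain re :: "'k \<Rightarrow> real" where re: "\<And>z. z = of_real (re z)" by metis
    have of_real: "re (of_real r) = r" for r
      using re[of "of_real r"] by (simp only: of_real_eq_iff)
    show ?thesis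
    proof (rule that[of re 0])
      show "linear re"
      proof (rule linearI)
        show "re (x + y) = re x + re y" for x y
          using of_real[of "re x + re y"] re[of x] re[of y] by simp
        show "re (r *\<^sub>R x) = r *\<^sub>R re x" for r x
          using of_real[of "r * re x"] re[of x] by (simp add: scaleR_conv_of_real)
      qed
      show "\<bar>re z\<bar> \<le> norm z" for z
        using norm_of_real[of "re z", where 'a='k] re[of z] by simp
    qed (use re of_real of_real[of 0] in auto)
  next
    case (complex i)
    then obtain re im :: "'k \<Rightarrow> real" where z: "\<And>z. z = of_real (re z) + of_real (im z) * i"
      and norm: "\<And>z. norm z = sqrt ((re z)\<^sup>2 + (im z)\<^sup>2)"
      by metis
    \<comment> \<open>If \<open>r + s * i = 0\<close>, squaring \<open>s * i = - r\<close> gives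
      \<open>r * r + s * s = 0\<close>, a real equation. This makes the chosen coordinates unique,
      hence \<open>re\<close> additive and homogeneous.\<close>
    have independent: "r = 0 \<and> s = 0" if "of_real r + of_real s * i = 0" for r s
    proof -
      have "of_real s * i = - of_real r"
        using that by (simp add: add_eq_0_iff)
      then have "(of_real s * i) * (of_real s * i) = of_real r * of_real r"
        by simp
      moreover have "(of_real s * i) * (of_real s * i) = - (of_real s * of_real s)"
      proof -
        have "(of_real s * i) * (of_real s * i) = (i * i) * (of_real s * of_real s)"
          by (simp add: algebra_simps)
        then show ?thesis by (simp add: complex(1))
      qed
      ultimately have "- (of_real s * of_real s) = (of_real r * of_real r :: 'k)"
        by simp
      then have "of_real (r * r + s * s) = (0 :: 'k)"
        by (simp add: neg_eq_iff_add_eq_0 add.commute)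
      then have "r * r + s * s = 0"
        by (simp only: of_real_eq_0_iff)
      then show ?thesis
        by (simp add: sum_squares_eq_zero_iff)
    qed
    have unique: "re (of_real r + of_real s * i) = r" "im (of_real r + of_real s * i) = s" for r s
    proof -
      define w where "w = of_real r + of_real s * i"
      have "of_real (re w - r) + of_real (im w - s) * i = w - (of_real r + of_real s * i)"
        using z[of w] by (simp add: algebra_simps)
      also have "\<dots> = 0" by (simp add: w_def)
      finally have "re w - r = 0 \<and> im w - s = 0"
        by (rule independent)
      then show "re (of_real r + of_real s * i) = r" "im (of_real r + of_real s * i) = s"
        by (simp_all add: w_def)
    qed
    have re_of_real: "re (of_real r) = r" for r
      using unique(1)[of r 0] by simp
    show ?thesis
    proof (rule that[of re i])
      show "linear re"
      proof (rule linearI)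
        show "re (x + y) = re x + re y" for x y
        proof -
          have "x + y = of_real (re x + re y) + of_real (im x + im y) * i"
            using z[of x] z[of y] by (simp add: algebra_simps)
          then show ?thesis using unique(1) by metis
        qed
        show "re (r *\<^sub>R x) = r *\<^sub>R re x" for r x
        proof -
          have "r *\<^sub>R x = of_real (r * re x) + of_real (r * im x) * i"
            by (subst z[of x]) (simp add: scaleR_conv_of_real distrib_left mult.assoc)
          then show ?thesis using unique(1) by (metis real_scaleR_def)
        qed
      qed
      show "\<bar>re w\<bar> \<le> norm w" for w
        by (simp add: norm real_le_rsqrt)
      show "re (of_real r * i) = 0" for r
        using unique(1)[of 0 r] by simp
      \<comment> \<open>Multiplication by \<open>i\<close> moves the imaginary part, with its sign
        changed, to the real part.\<close>
      show "w = of_real (re w) - of_real (re (i * w)) * i" for w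
      proof -
        have "i * w = i * (of_real (re w) + of_real (im w) * i)"
          using z[of w] by simp
        also have "\<dots> = (i * i) * of_real (im w) + of_real (re w) * i"
          by (simp add: algebra_simps)
        also have "\<dots> = of_real (- im w) + of_real (re w) * i"
          by (simp add: complex(1))
        finally have "re (i * w) = - im w"
          using unique(1) by metis
        then show ?thesis using z[of w] by simp
      qed
    qed (use re_of_real complex(1) in auto)
  qed
qed

context banach_space_over
begin

lemma dual_linear: "\<phi> \<in> dual_space scl \<Longrightarrow> bounded_linear \<phi>"
  and dual_scl: "\<phi> \<in> dual_space scl \<Longrightarrow> \<phi> (scl c x) = c * \<phi> x"
  by (auto simp: dual_space_def)

text \<open>Every functional over \<open>K\<close> is determined by its real part, so that the dual space can be
  parametrised by the Banach space of bounded real functionals.\<close>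

lemma dual_parametrisation:
  obtains L :: "('x \<Rightarrow>\<^sub>L real) \<Rightarrow> 'x \<Rightarrow> 'k"
  where "\<And>\<psi>. L \<psi> \<in> dual_space scl" "\<And>\<psi>. onorm (L \<psi>) \<le> norm \<psi>"
    "\<And>x. bounded_linear (\<lambda>\<psi>. L \<psi> x)" "\<And>\<psi> x. \<bar>blinfun_apply \<psi> x\<bar> \<le> norm (L \<psi> x)"
    "\<And>\<phi>. \<phi> \<in> dual_space scl \<Longrightarrow> \<exists>\<psi>. norm \<psi> \<le> onorm \<phi> \<and> L \<psi> = \<phi>"
proof -
  obtain re :: "'k \<Rightarrow> real" and j :: 'k
    where re: "linear re" "\<And>z. \<bar>re z\<bar> \<le> norm z" "\<And>r. re (of_real r) = r" "\<And>r. re (of_real r * j) = 0"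
      and z: "\<And>z. z = of_real (re z) - of_real (re (j * z)) * j" and j: "j = 0 \<or> j * j = - 1"
    using scalar_decomposition by blast
  have bl_scl: "bounded_linear (scl c)" for c
  proof (rule bounded_linear_intro[where K="norm c"])
    show "scl c (r *\<^sub>R x) = r *\<^sub>R scl c x" for r x
      by (simp add: mult.commute flip: scl_of_real)
  qed (simp_all add: scale_right_distrib norm_scl mult.commute)
  \<comment> \<open>This is the classical complexification of a real functional; with
    \<open>j = 0\<close> it is the functional itself, so both scalar fields share one
    formula.\<close>
  define L where "L \<psi> x = of_real (\<psi> x) - of_real (\<psi> (scl j x)) * j" for \<psi> :: "'x \<Rightarrow>\<^sub>L real" and x
  have re_L: "re (L \<psi> x) = \<psi> x" for \<psi> x
    by (simp add: L_def linear_diff[OF re(1)] re)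
  have bl1: "bounded_linear (\<lambda>x. L \<psi> x)" for \<psi>
    unfolding L_def
    by (intro bounded_linear_sub bounded_linear_mult_const
      bounded_linear_compose[OF bounded_linear_of_real]
      bounded_linear_compose[OF blinfun.bounded_linear_right] bl_scl blinfun.bounded_linear_right)
  have bl2: "bounded_linear (\<lambda>\<psi>. L \<psi> x)" for x
    unfolding L_def
    by (intro bounded_linear_sub bounded_linear_mult_const
      bounded_linear_compose[OF bounded_linear_of_real] blinfun.bounded_linear_left)
  have L_real: "L \<psi> (scl (of_real r) x) = of_real r * L \<psi> x" for \<psi> r x
    using linear_scale[OF bounded_linear.linear[OF bl1], of \<psi> r x]
    by (simp add: scl_of_real scaleR_conv_of_real)
  have L_j: "L \<psi> (scl j x) = j * L \<psi> x" for \<psi> x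
    using j
  proof
    assume jj: "j * j = - 1"
    have "j * (of_real r * j) = - of_real r" for r
      using jj by (metis mult.assoc mult.commute mult_minus1)
    then show ?thesis
      by (simp add: L_def jj right_diff_distrib blinfun.minus_right mult.commute)
  qed (simp add: L_def)
  have L_scl: "L \<psi> (scl c x) = c * L \<psi> x" for \<psi> c x
  proof -
    define r s where "r = re c" and "s = - re (j * c)"
    have c: "c = of_real r + of_real s * j"
      using z[of c] by (simp add: r_def s_def)
    have "L \<psi> (scl c x) = L \<psi> (scl (of_real r) x + scl (of_real s) (scl j x))"
      by (simp add: c scale_left_distrib)
    also have "\<dots> = of_real r * L \<psi> x + of_real s * (j * L \<psi> x)"
      by (simp only: linear_add[OF bounded_linear.linear[OF bl1]] L_real L_j)
    finally show ?thesis
      by (simp add: c algebra_simps)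
  qed
  have L_norm: "norm (L \<psi> x) \<le> norm \<psi> * norm x" for \<psi> x
  proof (cases "L \<psi> x = 0")
    case False
    \<comment> \<open>A scalar of modulus 1 rotates the value at \<open>x\<close> to a nonnegative
      real number. It then equals its real part \<open>\<psi> (scl c x)\<close>, so complexification
      does not increase the norm.\<close>
    define c where "c = of_real (norm (L \<psi> x)) / L \<psi> x"
    have c: "norm c = 1" "L \<psi> (scl c x) = of_real (norm (L \<psi> x))"
      using False by (simp_all add: c_def norm_divide L_scl)
    have "norm (L \<psi> x) = \<psi> (scl c x)"
      using re_L[of \<psi> "scl c x"] by (simp only: c(2) re(3))
    also have "\<dots> \<le> norm \<psi> * norm (scl c x)"
      using norm_blinfun[of \<psi> "scl c x"] by simp
    finally show ?thesis by (simp add: norm_scl c(1))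
  qed simp
  show ?thesis
  proof (rule that[of L])
    show "L \<psi> \<in> dual_space scl" for \<psi>
      using bl1[of \<psi>] L_scl by (simp add: dual_space_def)
    show "onorm (L \<psi>) \<le> norm \<psi>" for \<psi>
      using L_norm by (intro onorm_bound) auto
    show "bounded_linear (\<lambda>\<psi>. L \<psi> x)" for x
      by (rule bl2)
    show "\<bar>blinfun_apply \<psi> x\<bar> \<le> norm (L \<psi> x)" for \<psi> x
      using re(2)[of "L \<psi> x"] by (simp add: re_L)
    fix \<phi> assume \<phi>: "\<phi> \<in> dual_space scl"
    have bound: "norm (re (\<phi> x)) \<le> onorm \<phi> * norm x" for x
      using order_trans[OF re(2) onorm[OF dual_linear[OF \<phi>]]] by simp
    have "bounded_linear (\<lambda>x. re (\<phi> x))"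
      using bound bounded_linear.linear[OF dual_linear[OF \<phi>]] re(1)
      by (intro bounded_linear_intro[where K="onorm \<phi>"])
        (auto simp: linear_add linear_scale mult.commute)
    then have app: "blinfun_apply (Blinfun (\<lambda>x. re (\<phi> x))) = (\<lambda>x. re (\<phi> x))"
      by (rule bounded_linear_Blinfun_apply)
    \<comment> \<open>The preimage is the real part of \<open>\<phi>\<close>: as
      \<open>\<phi> (scl j x) = j * \<phi> x\<close>, the decomposition of the scalar
      \<open>\<phi> x\<close> rebuilds \<open>\<phi>\<close>.\<close>
    show "\<exists>\<psi>. norm \<psi> \<le> onorm \<phi> \<and> L \<psi> = \<phi>"
    proof (intro exI conjI)
      show "norm (Blinfun (\<lambda>x. re (\<phi> x))) \<le> onorm \<phi>"
        using bound by (intro norm_blinfun_bound onorm_pos_le dual_linear \<phi>) (simp add: app)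
      show "L (Blinfun (\<lambda>x. re (\<phi> x))) = \<phi>"
        using z by (simp add: fun_eq_iff L_def app dual_scl[OF \<phi>] flip: z)
    qed
  qed
qed

lemma dual_le:
  assumes "\<phi> \<in> dual_space scl" "onorm \<phi> \<le> 1"
  shows "norm (\<phi> x) \<le> norm x"
  using onorm[OF dual_linear[OF assms(1)], of x] mult_right_mono[OF assms(2) norm_ge_zero[of x]]
  by simp

text \<open>A real norming functional \<open>\<psi>\<close> lifts, because \<open>norm x =
  \<bar>\<psi> x\<bar> \<le> norm (L \<psi> x) \<le> norm x\<close>.\<close>

lemma norming_dual:
  obtains \<phi> where "\<phi> \<in> dual_space scl" "onorm \<phi> \<le> 1" "norm (\<phi> x) = norm x"
proof -
  obtain L :: "('x \<Rightarrow>\<^sub>L real) \<Rightarrow> 'x \<Rightarrow> 'k" where L: "\<And>\<psi>. L \<psi> \<in> dual_space scl"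
    "\<And>\<psi>. onorm (L \<psi>) \<le> norm \<psi>" "\<And>\<psi> x. \<bar>blinfun_apply \<psi> x\<bar> \<le> norm (L \<psi> x)"
    using dual_parametrisation by metis
  obtain \<psi> :: "'x \<Rightarrow>\<^sub>L real" where \<psi>: "norm \<psi> \<le> 1" "\<psi> x = norm x"
    using norming_functional by blast
  have le: "onorm (L \<psi>) \<le> 1"
    using L(2) \<psi>(1) order_trans by blast
  show ?thesis
    using L(3)[of \<psi> x] \<psi>(2) dual_le[OF L(1) le, of x] by (intro that[OF L(1) le]) simp
qed

lemma zero_dual: "(\<lambda>x. 0) \<in> dual_space scl"
  by (simp add: dual_space_def)

text \<open>Points of \<open>S\<close> act as evaluations on the Banach space of real functionals.
  Baire's theorem there makes them bounded by a common \<open>n\<close> on a ball of radius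
  \<open>r\<close>; a norming functional scaled to \<open>r / 2\<close> turns this into
  \<open>norm x \<le> 2 * n / r\<close>.\<close>

lemma weakly_bounded_imp_bounded:
  assumes "\<And>\<phi>. \<phi> \<in> dual_space scl \<Longrightarrow> bounded (\<phi> ` S)"
  shows "bounded S"
proof -
  obtain L :: "('x \<Rightarrow>\<^sub>L real) \<Rightarrow> 'x \<Rightarrow> 'k" where L: "\<And>\<psi>. L \<psi> \<in> dual_space scl"
    "\<And>\<psi> x. \<bar>blinfun_apply \<psi> x\<bar> \<le> norm (L \<psi> x)"
    using dual_parametrisation by metis
  define A where "A n = (\<Inter>x\<in>S. {\<psi> :: 'x \<Rightarrow>\<^sub>L real. \<bar>\<psi> x\<bar> \<le> real n})" for n
  have closed: "closed (A n)" for n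
    unfolding A_def by (intro closed_INT ballI closed_Collect_le continuous_intros)
  obtain n r where r: "0 < r" "ball 0 r \<subseteq> closure (A n)"
  proof (rule Baire_symmetric_convex_cover[of A])
    have "\<exists>n. \<psi> \<in> A n" for \<psi>
    proof -
      obtain b where b: "\<And>x. x \<in> S \<Longrightarrow> norm (L \<psi> x) \<le> b"
        using assms[OF L(1)[of \<psi>]] by (auto simp: bounded_iff)
      obtain n where n: "b \<le> real n"
        using real_arch_simple by blast
      have "\<bar>\<psi> x\<bar> \<le> real n" if "x \<in> S" for x
        using L(2)[of \<psi> x] b[OF that] n by linarith
      then show ?thesis by (auto simp: A_def)
    qed
    then show "(\<Union>n. A n) = UNIV" by auto
    show "convex (A n)" for n
      unfolding A_def
    proof (intro convex_INT convexI CollectI)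
      fix x \<psi>1 \<psi>2 and u v :: real
      assume "\<psi>1 \<in> {\<psi>. \<bar>blinfun_apply \<psi> x\<bar> \<le> real n}" "\<psi>2 \<in> {\<psi>. \<bar>blinfun_apply \<psi> x\<bar> \<le> real n}"
        and uv: "0 \<le> u" "0 \<le> v" "u + v = 1"
      then have "u * \<bar>\<psi>1 x\<bar> + v * \<bar>\<psi>2 x\<bar> \<le> u * n + v * n"
        by (intro add_mono mult_left_mono) auto
      moreover have "\<bar>(u *\<^sub>R \<psi>1 + v *\<^sub>R \<psi>2) x\<bar> \<le> u * \<bar>\<psi>1 x\<bar> + v * \<bar>\<psi>2 x\<bar>"
        using abs_triangle_ineq[of "u * \<psi>1 x" "v * \<psi>2 x"] uv
        by (simp add: blinfun.bilinear_simps abs_mult)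
      moreover have "u * n + v * n = n"
        using uv(3) by (simp flip: distrib_right)
      ultimately show "\<bar>(u *\<^sub>R \<psi>1 + v *\<^sub>R \<psi>2) x\<bar> \<le> real n"
        by simp
    qed
    show "- \<psi> \<in> A n" if "\<psi> \<in> A n" for n \<psi>
      using that by (auto simp: A_def blinfun.minus_left)
  qed
  have "norm x \<le> 2 * n / r" if "x \<in> S" for x
  proof -
    obtain \<psi> :: "'x \<Rightarrow>\<^sub>L real" where \<psi>: "norm \<psi> \<le> 1" "\<psi> x = norm x"
      using norming_functional by blast
    have "norm ((r / 2) *\<^sub>R \<psi>) \<le> r / 2"
      using \<psi>(1) r(1) by simp
    then have "(r / 2) *\<^sub>R \<psi> \<in> A n"
      using r by (intro subsetD[OF r(2)[unfolded closure_closed[OF closed]]]) simp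
    then have "\<bar>((r / 2) *\<^sub>R \<psi>) x\<bar> \<le> n"
      using that by (simp add: A_def)
    then show ?thesis
      using \<psi>(2) r(1) by (simp add: blinfun.scaleR_left field_simps)
  qed
  then show ?thesis by (auto simp: bounded_iff)
qed

end

section \<open>Weak function spaces\<close>

lemma (in banach_space_over) module_functions: "module (\<lambda>c f a. scl c (f a))"
  by standard (auto simp: fun_eq_iff scale_right_distrib scale_left_distrib)

lemma norm_le_sup_norm:
  assumes "b \<in> bounded_functions"
  shows "norm (b a) \<le> sup_norm b"
proof -
  obtain c where "\<And>a. norm (b a) \<le> c"
    using assms by (auto simp: bounded_functions_def bounded_iff)
  then have "bdd_above (range (\<lambda>a. norm (b a)))"
    by (rule bdd_aboveI2)
  then show ?thesis
    unfolding sup_norm_def by (intro cSUP_upper) auto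
qed

locale weak_BK_space = banach_space_over scl + scalar_BK_space U N
  for scl :: "'k::real_or_complex \<Rightarrow> 'x::banach \<Rightarrow> 'x"
    and U :: "('d \<Rightarrow> 'k) set"
    and N :: "('d \<Rightarrow> 'k) \<Rightarrow> real"
begin

section \<open>Finiteness of the weak norm and the norm axioms\<close>

lemma weak_spaceD: "f \<in> weak_space scl U \<Longrightarrow> \<phi> \<in> dual_space scl \<Longrightarrow> \<phi> \<circ> f \<in> U"
  by (simp add: weak_space_def)

lemma dual_comp:
  assumes "\<phi> \<in> dual_space scl"
  shows "\<phi> \<circ> 0 = 0" "\<phi> \<circ> (f + g) = (\<phi> \<circ> f) + (\<phi> \<circ> g)" "\<phi> \<circ> (f - g) = (\<phi> \<circ> f) - (\<phi> \<circ> g)"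
    "\<phi> \<circ> (\<lambda>a. scl (b a) (h a)) = (\<lambda>a. b a * (\<phi> \<circ> h) a)"
  using bounded_linear.linear[OF dual_linear[OF assms]]
  by (auto simp: fun_eq_iff linear_0 linear_add linear_diff dual_scl[OF assms])

lemma subspace_weak_space: "module.subspace (\<lambda>c f a. scl c (f a)) (weak_space scl U)"
proof (rule module.subspaceI[OF module_functions])
  show "0 \<in> weak_space scl U"
    by (simp add: weak_space_def dual_comp zero_mem)
  show "f + g \<in> weak_space scl U" if "f \<in> weak_space scl U" "g \<in> weak_space scl U" for f g
    using that by (simp add: weak_space_def dual_comp add_mem)
  show "(\<lambda>a. scl c (f a)) \<in> weak_space scl U" if "f \<in> weak_space scl U" for c f
    using that by (simp add: weak_space_def dual_comp scale_mem del: o_apply)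
qed

lemmas weak_zero_mem = module.subspace_0[OF module_functions subspace_weak_space]
  and weak_diff_mem = module.subspace_diff[OF module_functions subspace_weak_space]
  and weak_scale_mem = module.subspace_scale[OF module_functions subspace_weak_space]

text \<open>The closed graph bound is applied to \<open>L \<psi> \<circ> f\<close> on real
  functionals. Its constant \<open>C\<close> bounds all values, since each \<open>\<phi>\<close> of
  norm at most 1 is some \<open>L \<psi>\<close> with \<open>norm \<psi> \<le> 1\<close>.\<close>

lemma bdd_above_weak_norm_values:
  assumes f: "f \<in> weak_space scl U"
  shows "bdd_above (weak_norm_values scl N f)"
proof -
  obtain L :: "('x \<Rightarrow>\<^sub>L real) \<Rightarrow> 'x \<Rightarrow> 'k" where L: "\<And>\<psi>. L \<psi> \<in> dual_space scl"
    "\<And>x. bounded_linear (\<lambda>\<psi>. L \<psi> x)"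
    "\<And>\<phi>. \<phi> \<in> dual_space scl \<Longrightarrow> \<exists>\<psi>. norm \<psi> \<le> onorm \<phi> \<and> L \<psi> = \<phi>"
    using dual_parametrisation by metis
  obtain C where C: "0 \<le> C" "\<And>\<psi>. N (L \<psi> \<circ> f) \<le> C * norm \<psi>"
    using closed_graph_bound[of "\<lambda>\<psi>. L \<psi> \<circ> f"] weak_spaceD[OF f L(1)] L(2) by auto
  show ?thesis
    unfolding weak_norm_values_def
  proof (rule bdd_aboveI, safe)
    fix \<phi> assume \<phi>: "\<phi> \<in> dual_space scl" "onorm \<phi> \<le> 1"
    with L(3) obtain \<psi> where \<psi>: "norm \<psi> \<le> 1" "L \<psi> = \<phi>"
      using order_trans by blast
    then show "N (\<phi> \<circ> f) \<le> C"
      using C(2)[of \<psi>] mult_left_mono[OF \<psi>(1) C(1)] by simp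
  qed
qed

lemma weak_norm_ge:
  "f \<in> weak_space scl U \<Longrightarrow> \<phi> \<in> dual_space scl \<Longrightarrow> onorm \<phi> \<le> 1 \<Longrightarrow> N (\<phi> \<circ> f) \<le> weak_norm scl N f"
  unfolding weak_norm_def
  by (intro cSup_upper bdd_above_weak_norm_values) (auto simp: weak_norm_values_def)

lemma weak_norm_le:
  assumes "\<And>\<phi>. \<phi> \<in> dual_space scl \<Longrightarrow> onorm \<phi> \<le> 1 \<Longrightarrow> N (\<phi> \<circ> f) \<le> c"
  shows "weak_norm scl N f \<le> c"
  unfolding weak_norm_def
proof (rule cSup_least)
  \<comment> \<open>The zero functional guarantees that the supremum is taken over a nonempty
    set.\<close>
  show "weak_norm_values scl N f \<noteq> {}"
    using zero_dual by (auto simp: weak_norm_values_def onorm_zero intro!: exI[of _ "\<lambda>x. 0"])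
qed (use assms in \<open>auto simp: weak_norm_values_def\<close>)

lemma weak_norm_nonneg:
  assumes "f \<in> weak_space scl U"
  shows "0 \<le> weak_norm scl N f"
proof (rule order_trans)
  show "0 \<le> N ((\<lambda>x. 0) \<circ> f)"
    by (intro N_nonneg weak_spaceD assms zero_dual)
  show "N ((\<lambda>x. 0) \<circ> f) \<le> weak_norm scl N f"
    by (intro weak_norm_ge assms zero_dual) (simp add: onorm_zero)
qed

lemma weak_evaluation_bound:
  obtains C where "0 \<le> C" "\<And>f. f \<in> weak_space scl U \<Longrightarrow> norm (f a) \<le> C * weak_norm scl N f"
proof -
  obtain C where C: "0 \<le> C" "\<And>u. u \<in> U \<Longrightarrow> norm (u a) \<le> C * N u"
    using evaluation_bound by blast
  show ?thesis
  proof (rule that[OF C(1)])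
    fix f assume f: "f \<in> weak_space scl U"
    obtain \<phi> where \<phi>: "\<phi> \<in> dual_space scl" "onorm \<phi> \<le> 1" "norm (\<phi> (f a)) = norm (f a)"
      using norming_dual by blast
    have "norm (f a) \<le> C * N (\<phi> \<circ> f)"
      using C(2)[OF weak_spaceD[OF f \<phi>(1)]] \<phi>(3) by simp
    also have "\<dots> \<le> C * weak_norm scl N f"
      by (intro mult_left_mono weak_norm_ge f \<phi> C(1))
    finally show "norm (f a) \<le> C * weak_norm scl N f" .
  qed
qed

lemma weak_norm_scale_le:
  assumes f: "f \<in> weak_space scl U"
  shows "weak_norm scl N (\<lambda>a. scl c (f a)) \<le> norm c * weak_norm scl N f"
proof (rule weak_norm_le)
  fix \<phi> assume \<phi>: "\<phi> \<in> dual_space scl" "onorm \<phi> \<le> 1"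
  have "N (\<phi> \<circ> (\<lambda>a. scl c (f a))) = norm c * N (\<phi> \<circ> f)"
    by (simp only: dual_comp(4)[OF \<phi>(1)] N_scale[OF weak_spaceD[OF f \<phi>(1)]])
  then show "N (\<phi> \<circ> (\<lambda>a. scl c (f a))) \<le> norm c * weak_norm scl N f"
    using weak_norm_ge[OF f \<phi>] by (simp add: mult_left_mono)
qed

lemma norm_on_weak_space: "norm_on scl (weak_space scl U) (weak_norm scl N)"
  unfolding norm_on_def
proof (intro conjI ballI allI)
  fix f assume f: "f \<in> weak_space scl U"
  show "0 \<le> weak_norm scl N f"
    by (rule weak_norm_nonneg[OF f])
  show "weak_norm scl N f = 0 \<longleftrightarrow> f = 0"
  proof
    assume *: "weak_norm scl N f = 0"
    show "f = 0"
    proof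
      fix a
      obtain C where "norm (f a) \<le> C * weak_norm scl N f"
        using weak_evaluation_bound f by blast
      with * show "f a = 0 a" by simp
    qed
  next
    assume "f = 0"
    moreover have "weak_norm scl N 0 \<le> 0"
      using N_eq_0_iff[OF zero_mem] by (intro weak_norm_le) (simp add: dual_comp)
    ultimately show "weak_norm scl N f = 0"
      using weak_norm_nonneg[OF f] by simp
  qed
  show "weak_norm scl N (f + g) \<le> weak_norm scl N f + weak_norm scl N g"
    if g: "g \<in> weak_space scl U" for g
  proof (rule weak_norm_le)
    fix \<phi> assume \<phi>: "\<phi> \<in> dual_space scl" "onorm \<phi> \<le> 1"
    have "N (\<phi> \<circ> (f + g)) \<le> N (\<phi> \<circ> f) + N (\<phi> \<circ> g)"
      unfolding dual_comp(2)[OF \<phi>(1)] by (intro N_add weak_spaceD f g \<phi>)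
    also have "\<dots> \<le> weak_norm scl N f + weak_norm scl N g"
      by (intro add_mono weak_norm_ge f g \<phi>)
    finally show "N (\<phi> \<circ> (f + g)) \<le> weak_norm scl N f + weak_norm scl N g" .
  qed
  show "weak_norm scl N (\<lambda>a. scl c (f a)) = norm c * weak_norm scl N f" for c
  proof (cases "c = 0")
    case True
    moreover have "weak_norm scl N 0 = 0"
    proof (rule antisym[OF weak_norm_le weak_norm_nonneg[OF weak_zero_mem]])
      show "N (\<phi> \<circ> 0) \<le> 0" if "\<phi> \<in> dual_space scl" for \<phi>
        using that N_eq_0_iff[OF zero_mem] by (simp add: dual_comp)
    qed
    ultimately show ?thesis by (simp add: zero_fun_def)
  next
    case False
    \<comment> \<open>Undoing the scaling with \<open>inverse c\<close> turns the one-sided estimate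
      into the reverse inequality.\<close>
    have "weak_norm scl N f = weak_norm scl N (\<lambda>a. scl (inverse c) (scl c (f a)))"
      using False by simp
    also have "\<dots> \<le> norm (inverse c) * weak_norm scl N (\<lambda>a. scl c (f a))"
      by (intro weak_norm_scale_le weak_scale_mem f)
    finally have "norm c * weak_norm scl N f \<le> weak_norm scl N (\<lambda>a. scl c (f a))"
      using False by (simp add: norm_inverse norm_divide field_simps)
    with weak_norm_scale_le[OF f, of c] show ?thesis by simp
  qed
qed

section \<open>Completeness of the weak norm\<close>

lemma weak_norm_complete:
  fixes s :: "nat \<Rightarrow> 'd \<Rightarrow> 'x"
  assumes s: "\<And>n. s n \<in> weak_space scl U"
    and Cauchy: "\<And>\<epsilon>. 0 < \<epsilon> \<Longrightarrow> \<exists>M. \<forall>m\<ge>M. \<forall>n\<ge>M. weak_norm scl N (s m - s n) < \<epsilon>"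
  shows "\<exists>f\<in>weak_space scl U. (\<lambda>n. weak_norm scl N (s n - f)) \<longlonglongrightarrow> 0"
proof -
  note diff = weak_diff_mem[OF s s]
  have "convergent (\<lambda>n. s n a)" for a
  proof (rule Cauchy_convergent, rule CauchyI)
    fix \<epsilon> :: real assume \<epsilon>: "0 < \<epsilon>"
    obtain C where C: "0 \<le> C" "\<And>f. f \<in> weak_space scl U \<Longrightarrow> norm (f a) \<le> C * weak_norm scl N f"
      using weak_evaluation_bound by blast
    \<comment> \<open>The constant \<open>C\<close> may be \<open>0\<close>, so \<open>C + 1\<close>
      is used as divisor.\<close>
    have "0 < \<epsilon> / (C + 1)" using C(1) \<epsilon> by simp
    from Cauchy[OF this] obtain M
      where M: "\<And>m n. M \<le> m \<Longrightarrow> M \<le> n \<Longrightarrow> weak_norm scl N (s m - s n) < \<epsilon> / (C + 1)"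
      by blast
    have "norm (s m a - s n a) < \<epsilon>" if "M \<le> m" "M \<le> n" for m n
    proof -
      have "norm (s m a - s n a) \<le> C * weak_norm scl N (s m - s n)"
        using C(2)[OF diff, of m n] by simp
      also have "\<dots> \<le> (C + 1) * weak_norm scl N (s m - s n)"
        by (intro mult_right_mono weak_norm_nonneg diff) simp
      also have "\<dots> < \<epsilon>"
        using M[OF that] C(1) by (simp add: field_simps)
      finally show ?thesis .
    qed
    then show "\<exists>M. \<forall>m\<ge>M. \<forall>n\<ge>M. norm (s m a - s n a) < \<epsilon>" by blast
  qed
  then obtain f where f: "\<And>a. (\<lambda>n. s n a) \<longlonglongrightarrow> f a"
    unfolding convergent_def by metis
  have limit: "\<phi> \<circ> f \<in> U \<and> (\<lambda>n. N ((\<phi> \<circ> s n) - (\<phi> \<circ> f))) \<longlonglongrightarrow> 0"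
    if \<phi>: "\<phi> \<in> dual_space scl" "onorm \<phi> \<le> 1" for \<phi>
  proof -
    note mem = weak_spaceD[OF s \<phi>(1)]
    obtain u where u: "u \<in> U" "(\<lambda>n. N ((\<phi> \<circ> s n) - u)) \<longlonglongrightarrow> 0"
    proof (rule N_Cauchy_convergent[of "\<lambda>n. \<phi> \<circ> s n", OF mem])
      fix \<epsilon> :: real assume "0 < \<epsilon>"
      moreover have "N ((\<phi> \<circ> s m) - (\<phi> \<circ> s n)) \<le> weak_norm scl N (s m - s n)" for m n
        using weak_norm_ge[OF diff \<phi>, of m n] by (simp add: dual_comp[OF \<phi>(1)])
      ultimately show "\<exists>M. \<forall>m\<ge>M. \<forall>n\<ge>M. N ((\<phi> \<circ> s m) - (\<phi> \<circ> s n)) < \<epsilon>"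
        using Cauchy le_less_trans by meson
    qed
    have "u = \<phi> \<circ> f"
    proof
      fix a
      have "(\<lambda>n. \<phi> (s n a)) \<longlonglongrightarrow> u a"
        using tendsto_evaluation[OF mem u] by simp
      moreover have "(\<lambda>n. \<phi> (s n a)) \<longlonglongrightarrow> \<phi> (f a)"
        by (rule bounded_linear.tendsto[OF dual_linear[OF \<phi>(1)] f])
      ultimately show "u a = (\<phi> \<circ> f) a"
        using LIMSEQ_unique by fastforce
    qed
    with u show ?thesis by simp
  qed
  have "\<phi> \<circ> f \<in> U" if \<phi>: "\<phi> \<in> dual_space scl" for \<phi>
  proof -
    \<comment> \<open>The weak norm controls only functionals of norm at most 1, so
      \<open>\<phi>\<close> is divided by \<open>k\<close>; adding 1 keeps \<open>k\<close> positive
      when \<open>\<phi>\<close> is zero.\<close>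
    define k where "k = onorm \<phi> + 1"
    have k: "0 < k" using onorm_pos_le[OF dual_linear[OF \<phi>]] by (simp add: k_def)
    define \<eta> where "\<eta> x = of_real (inverse k) * \<phi> x" for x
    have "\<eta> \<in> dual_space scl"
      using bounded_linear_compose[OF bounded_linear_mult_right dual_linear[OF \<phi>]]
      by (simp add: \<eta>_def[abs_def] dual_space_def dual_scl[OF \<phi>])
    moreover have "onorm \<eta> \<le> 1"
    proof (rule onorm_bound)
      fix x
      have "norm (\<eta> x) = inverse k * norm (\<phi> x)"
        using k by (simp only: \<eta>_def norm_mult norm_of_real) simp
      also have "\<dots> \<le> inverse k * (k * norm x)"
      proof (rule mult_left_mono)
        show "norm (\<phi> x) \<le> k * norm x"
          using onorm[OF dual_linear[OF \<phi>], of x] norm_ge_zero[of x]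
          unfolding k_def distrib_right by linarith
      qed (use k in simp)
      finally show "norm (\<eta> x) \<le> 1 * norm x"
        using k by (simp flip: mult.assoc)
    qed simp
    ultimately have "\<eta> \<circ> f \<in> U"
      by (rule limit[THEN conjunct1])
    moreover have "(\<lambda>a. of_real k * (\<eta> \<circ> f) a) = \<phi> \<circ> f"
      using k by (simp add: fun_eq_iff \<eta>_def)
    ultimately show ?thesis
      using scale_mem[of "\<eta> \<circ> f" "of_real k"] by simp
  qed
  then have fW: "f \<in> weak_space scl U"
    by (simp add: weak_space_def)
  have "(\<lambda>n. weak_norm scl N (s n - f)) \<longlonglongrightarrow> 0"
  proof (rule LIMSEQ_I)
    fix \<epsilon> :: real assume "0 < \<epsilon>"
    then obtain M where M: "\<And>m n. M \<le> m \<Longrightarrow> M \<le> n \<Longrightarrow> weak_norm scl N (s m - s n) < \<epsilon> / 2"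
      using Cauchy[of "\<epsilon> / 2"] by auto
    have le: "weak_norm scl N (s n - f) \<le> \<epsilon> / 2" if n: "M \<le> n" for n
    proof (rule weak_norm_le)
      fix \<phi> assume \<phi>: "\<phi> \<in> dual_space scl" "onorm \<phi> \<le> 1"
      note mem = weak_spaceD[OF s \<phi>(1)]
      \<comment> \<open>With \<open>n\<close> fixed, \<open>m\<close> tends to infinity and the last
        term vanishes. As \<open>M\<close> was chosen before \<open>\<phi>\<close>, the bound holds
        uniformly over the dual unit ball.\<close>
      have "N (\<phi> \<circ> (s n - f)) \<le> \<epsilon> / 2 + N ((\<phi> \<circ> s m) - (\<phi> \<circ> f))" if "M \<le> m" for m
        using N_diff_triangle[OF mem[of n] mem[of m] weak_spaceD[OF fW \<phi>(1)]]
          weak_norm_ge[OF diff \<phi>, of n m] M[OF n that]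
        by (simp add: dual_comp[OF \<phi>(1)])
      moreover have "(\<lambda>m. \<epsilon> / 2 + N ((\<phi> \<circ> s m) - (\<phi> \<circ> f))) \<longlonglongrightarrow> \<epsilon> / 2 + 0"
        using limit[OF \<phi>] by (intro tendsto_intros) simp
      ultimately have "N (\<phi> \<circ> (s n - f)) \<le> \<epsilon> / 2 + 0"
        by (intro LIMSEQ_le_const) auto
      then show "N (\<phi> \<circ> (s n - f)) \<le> \<epsilon> / 2"
        by simp
    qed
    show "\<exists>M. \<forall>n\<ge>M. norm (weak_norm scl N (s n - f) - 0) < \<epsilon>"
    proof (intro exI allI impI)
      fix n assume "M \<le> n"
      then show "norm (weak_norm scl N (s n - f) - 0) < \<epsilon>"
        using le[of n] weak_norm_nonneg[OF weak_diff_mem[OF s fW], of n] \<open>0 < \<epsilon>\<close> by simp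
    qed
  qed
  then show ?thesis using fW by (rule bexI)
qed

lemma BK_space_weak_space: "BK_space scl (weak_space scl U) (weak_norm scl N)"
  unfolding BK_space_def complete_norm_on_def fun_subspace_def
proof (intro conjI allI impI ballI)
  show "\<exists>f\<in>weak_space scl U. (\<lambda>n. weak_norm scl N (s n - f)) \<longlonglongrightarrow> 0"
    if "(\<forall>n. s n \<in> weak_space scl U) \<and>
      (\<forall>\<epsilon>>0. \<exists>M. \<forall>m\<ge>M. \<forall>n\<ge>M. weak_norm scl N (s m - s n) < \<epsilon>)" for s
    using that by (intro weak_norm_complete) simp_all
  fix a f and \<epsilon> :: real
  assume f: "f \<in> weak_space scl U" and \<epsilon>: "0 < \<epsilon>"
  obtain C where C: "0 \<le> C" "\<And>f. f \<in> weak_space scl U \<Longrightarrow> norm (f a) \<le> C * weak_norm scl N f"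
    using weak_evaluation_bound by blast
  show "\<exists>\<delta>>0. \<forall>g\<in>weak_space scl U. weak_norm scl N (g - f) < \<delta> \<longrightarrow> norm (g a - f a) < \<epsilon>"
  proof (intro exI conjI ballI impI)
    show "0 < \<epsilon> / (C + 1)" using \<epsilon> C(1) by simp
    fix g assume g: "g \<in> weak_space scl U" "weak_norm scl N (g - f) < \<epsilon> / (C + 1)"
    have "norm (g a - f a) \<le> C * weak_norm scl N (g - f)"
      using C(2)[OF weak_diff_mem[OF g(1) f]] by simp
    also have "\<dots> \<le> (C + 1) * weak_norm scl N (g - f)"
      by (intro mult_right_mono weak_norm_nonneg weak_diff_mem g(1) f) simp
    also have "\<dots> < \<epsilon>"
      using g(2) C(1) by (simp add: field_simps)
    finally show "norm (g a - f a) < \<epsilon>" .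
  qed
qed (rule subspace_weak_space norm_on_weak_space)+

text \<open>A product with a bounded function is dominated by a constant multiple, which stays in
  the subspace \<open>U\<close>. Both ideal properties follow from this; the constant becomes the
  factor \<open>sup_norm b\<close> in the norm estimate.\<close>

lemma bounded_multiple_le:
  fixes b :: "'d \<Rightarrow> 'k"
  assumes "b \<in> bounded_functions"
  shows "norm (b a * g a) \<le> norm (of_real (sup_norm b) * g a :: 'k)"
  using order_trans[OF norm_le_sup_norm[OF assms, of a] abs_ge_self]
  by (simp add: norm_mult mult_right_mono)

lemma b_ideal_weak_space:
  assumes "order_ideal U"
  shows "b_ideal scl (weak_space scl U)"
  unfolding b_ideal_def fun_subspace_def
proof (intro conjI ballI subspace_weak_space)
  fix b :: "'d \<Rightarrow> 'k" and f assume b: "b \<in> bounded_functions" and f: "f \<in> weak_space scl U"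
  have ideal: "g \<in> U" if "h \<in> U" "\<And>a. norm (g a) \<le> norm (h a)" for g h
    using assms that by (auto simp: order_ideal_def)
  have "(\<lambda>a. b a * (\<phi> \<circ> f) a) \<in> U" if "\<phi> \<in> dual_space scl" for \<phi>
    by (rule ideal[where h = "\<lambda>a. of_real (sup_norm b) * (\<phi> \<circ> f) a"])
      (intro scale_mem weak_spaceD f that bounded_multiple_le b)+
  then show "(\<lambda>a. scl (b a) (f a)) \<in> weak_space scl U"
    by (simp add: weak_space_def dual_comp(4) del: o_apply)
qed

lemma BK_b_ideal_weak_space:
  assumes U: "Banach_ideal U N"
  shows "BK_b_ideal scl (weak_space scl U) (weak_norm scl N)"
  unfolding BK_b_ideal_def
proof (intro conjI ballI BK_space_weak_space)
  show b_ideal: "b_ideal scl (weak_space scl U)"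
    using U by (intro b_ideal_weak_space) (simp add: Banach_ideal_def)
  fix b :: "'d \<Rightarrow> 'k" and f assume b: "b \<in> bounded_functions" and f: "f \<in> weak_space scl U"
  have sup_norm: "0 \<le> sup_norm b"
    using order_trans[OF norm_ge_zero norm_le_sup_norm[OF b]] .
  have bf: "(\<lambda>a. scl (b a) (f a)) \<in> weak_space scl U"
    using b_ideal b f by (simp add: b_ideal_def)
  have mono: "N g \<le> N h" if "g \<in> U" "h \<in> U" "\<And>a. norm (g a) \<le> norm (h a)" for g h
    using U that by (simp add: Banach_ideal_def)
  show "weak_norm scl N (\<lambda>a. scl (b a) (f a)) \<le> sup_norm b * weak_norm scl N f"
  proof (rule weak_norm_le)
    fix \<phi> assume \<phi>: "\<phi> \<in> dual_space scl" "onorm \<phi> \<le> 1"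
    note mem = weak_spaceD[OF f \<phi>(1)]
    have "(\<lambda>a. b a * (\<phi> \<circ> f) a) \<in> U"
      using weak_spaceD[OF bf \<phi>(1)] by (simp only: dual_comp(4)[OF \<phi>(1)])
    then have "N (\<lambda>a. b a * (\<phi> \<circ> f) a) \<le> N (\<lambda>a. of_real (sup_norm b) * (\<phi> \<circ> f) a)"
      using scale_mem[OF mem] by (intro mono bounded_multiple_le b)
    also have "\<dots> = sup_norm b * N (\<phi> \<circ> f)"
      using sup_norm by (simp only: N_scale[OF mem] norm_of_real abs_of_nonneg)
    also have "\<dots> \<le> sup_norm b * weak_norm scl N f"
      by (intro mult_left_mono weak_norm_ge f \<phi> sup_norm)
    finally show "N (\<phi> \<circ> (\<lambda>a. scl (b a) (f a))) \<le> sup_norm b * weak_norm scl N f"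
      by (simp only: dual_comp(4)[OF \<phi>(1)])
  qed
qed

text \<open>For \<open>u\<close> in \<open>U\<close>, the function with values
  \<open>scl (u a) x\<close> composes with \<open>\<phi>\<close> to the multiple of \<open>u\<close>
  by \<open>\<phi> x\<close>. The nonzero vector is essential: over the zero space every function
  vanishes everywhere.\<close>

lemma nowhere_vanishing_weak_space:
  assumes U: "nowhere_vanishing U" and x: "(x :: 'x) \<noteq> 0"
  shows "nowhere_vanishing (weak_space scl U)"
  unfolding nowhere_vanishing_def
proof
  fix a
  obtain u where u: "u \<in> U" "u a \<noteq> 0"
    using U by (auto simp: nowhere_vanishing_def)
  have "(\<lambda>a. scl (u a) x) \<in> weak_space scl U"
    using scale_mem[OF u(1)] by (simp add: weak_space_def comp_def dual_scl mult.commute)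
  then show "\<exists>f\<in>weak_space scl U. f a \<noteq> 0"
    by (rule bexI[rotated]) (use u(2) x in simp)
qed

text \<open>On the finite support of \<open>f\<close>, the composition with \<open>\<phi>\<close> is
  the linear combination of point indicators with coefficients \<open>\<phi> (f c)\<close>.\<close>

lemma finitely_supported_subset_weak_space:
  assumes U: "\<And>a. indicator {a} \<in> U"
  shows "finitely_supported \<subseteq> weak_space scl U"
proof
  fix f :: "'d \<Rightarrow> 'x"
  assume "f \<in> finitely_supported"
  then have fin: "finite {a. f a \<noteq> 0}" by (simp add: finitely_supported_def)
  have "\<phi> \<circ> f \<in> U" if \<phi>: "\<phi> \<in> dual_space scl" for \<phi>
  proof -
    have "(\<Sum>c\<in>{a. f a \<noteq> 0}. (\<lambda>a. \<phi> (f c) * indicator {c} a)) \<in> U"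
      by (intro sum_mem scale_mem U)
    also have "(\<Sum>c\<in>{a. f a \<noteq> 0}. (\<lambda>a. \<phi> (f c) * indicator {c} a)) = \<phi> \<circ> f"
    proof
      fix a
      have sum_apply: "(\<Sum>c\<in>A. g c) a = (\<Sum>c\<in>A. g c a)" for A and g :: "'d \<Rightarrow> 'd \<Rightarrow> 'k"
        by (induction A rule: infinite_finite_induct) auto
      have "(\<Sum>c\<in>{a. f a \<noteq> 0}. \<phi> (f c) * indicator {c} a) =
        (\<Sum>c\<in>{a. f a \<noteq> 0}. if a = c then \<phi> (f c) else 0)"
        by (intro sum.cong) (auto simp: indicator_def)
      also have "\<dots> = \<phi> (f a)"
        using fin linear_0[OF bounded_linear.linear[OF dual_linear[OF \<phi>]]] by simp
      finally show "(\<Sum>c\<in>{a. f a \<noteq> 0}. (\<lambda>a. \<phi> (f c) * indicator {c} a)) a = (\<phi> \<circ> f) a"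
        by (simp add: sum_apply)
    qed
    finally show ?thesis .
  qed
  then show "f \<in> weak_space scl U" by (simp add: weak_space_def)
qed

lemma weak_space_subset_bounded_functions:
  assumes "U \<subseteq> bounded_functions"
  shows "weak_space scl U \<subseteq> bounded_functions"
proof
  fix f assume f: "f \<in> weak_space scl U"
  have "bounded (range f)"
  proof (rule weakly_bounded_imp_bounded)
    show "bounded (\<phi> ` range f)" if "\<phi> \<in> dual_space scl" for \<phi>
      using weak_spaceD[OF f that] assms by (auto simp: bounded_functions_def image_comp)
  qed
  then show "f \<in> bounded_functions" by (simp add: bounded_functions_def)
qed

end

theorem theorem11p1:
  fixes scl :: "'k::real_or_complex \<Rightarrow> 'x::banach \<Rightarrow> 'x"
    and U :: "('d \<Rightarrow> 'k) set"
    and N :: "('d \<Rightarrow> 'k) \<Rightarrow> real"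
  assumes "banach_space_over scl"
    and "BK_space (*) U N"
  shows "(\<forall>f\<in>weak_space scl U. bdd_above (weak_norm_values scl N f)) \<and>
    BK_space scl (weak_space scl U) (weak_norm scl N) \<and>
    (order_ideal U \<longrightarrow> b_ideal scl (weak_space scl U)) \<and>
    (Banach_ideal U N \<longrightarrow> BK_b_ideal scl (weak_space scl U) (weak_norm scl N)) \<and>
    (nowhere_vanishing U \<and> (\<exists>x::'x. x \<noteq> 0) \<longrightarrow> nowhere_vanishing (weak_space scl U)) \<and>
    ((\<forall>a. indicator {a} \<in> U) \<longrightarrow> finitely_supported \<subseteq> weak_space scl U) \<and>
    (U \<subseteq> bounded_functions \<longrightarrow> weak_space scl U \<subseteq> bounded_functions)"
proof -
  interpret banach_space_over scl by fact
  interpret weak_BK_space scl U N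
    by unfold_locales fact
  show ?thesis
    by (intro conjI ballI impI; (elim conjE exE)?)
      (simp_all add: bdd_above_weak_norm_values BK_space_weak_space b_ideal_weak_space
        BK_b_ideal_weak_space nowhere_vanishing_weak_space finitely_supported_subset_weak_space
        weak_space_subset_bounded_functions)
qed

end
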